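(* Let $\mathcal{A}:\mathbb{R}^{m\times n}\to\mathbb{R}^p$ be a linear map and suppose that $b=\mathcal{A}X+e$, where $X\in\mathbb{R}^{m\times n}$ is an arbitrary matrix and $e\in\mathbb{R}^p$. Suppose $\mathcal{A}$ has the restricted isometry property with $\delta_{3r}(\mathcal{A})\le\alpha/\sqrt{8}$, where $\alpha\in(0,1)$. Let $X_r$ be the best rank-$r$ approximation to $X$. Let $X^0,X^1,X^2,\ldots$ be the iterates produced by the algorithm IHT (Iterative Hard Thresholding, defined in the context) with data $\mathcal{A},b,r$ and given initial matrix $X^0\in\mathbb{R}^{m\times n}$. Then, at iteration $k$, IHT will recover an approximation $X^k$ satisfying $$\|X-X^k\|_F\le\alpha^k\|X_r-X^0\|_F+\gamma\tilde{\epsilon}_r,$$ where $\gamma:=\frac{\beta^2}{2(1-\alpha)}+1$, $\beta:=2\sqrt{1+\alpha/\sqrt{8}}$, and $$\tilde{\epsilon}_r=\|X-X_r\|_F+\frac{1}{\sqrt{r}}\|X-X_r\|_*+\|e\|_2 .$$ Furthermore, after at most $$k^*:=\left\lceil\log_{1/\alpha}\left(\|X_r-X^0\|_F/\tilde{\epsilon}_r\right)\right\rceil$$ iterations, IHT estimates $X$ with accuracy $$\|X-X^{k^*}\|_F\le(1+\gamma)\tilde{\epsilon}_r .$$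
   Context: Throughout $m\le n$. $\|\cdot\|_F$ is the Frobenius norm on $\mathbb{R}^{m\times n}$ (with inner product $\langle X,Y\rangle=\mathrm{Tr}(X^\top Y)$), $\|\cdot\|_*$ is the nuclear norm (sum of singular values), $\|\cdot\|_2$ is the Euclidean norm on $\mathbb{R}^p$, and $\mathcal{A}^*:\mathbb{R}^p\to\mathbb{R}^{m\times n}$ is the adjoint of $\mathcal{A}$. $\mathcal{A}X$ means $\mathcal{A}(X)$. Restricted isometry constant: for an integer $s$ with $1\le s\le m$, $\delta_s(\mathcal{A})$ is the minimum constant such that $(1-\delta_s(\mathcal{A}))\|X\|_F^2\le\|\mathcal{A}X\|_2^2\le(1+\delta_s(\mathcal{A}))\|X\|_F^2$ for all $X\in\mathbb{R}^{m\times n}$ with $\mathrm{rank}(X)\le s$. Best rank-$r$ approximation (hard thresholding): if $X=\sum_{i=1}^m\sigma_iu_iv_i^\top$ is the singular value decomposition of $X$ with $\sigma_1\ge\cdots\ge\sigma_m$, then $R_r(X)=\sum_{i=1}^r\sigma_iu_iv_i^\top$. Algorithm IHT: given $X^0$ and $r$, for $k=0,1,2,\ldots$ set $Y^{k+1}:=X^k-\mathcal{A}^*(\mathcal{A}X^k-b)$ and $X^{k+1}:=R_r(Y^{k+1})$.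
   Formalization: The initial matrix X^0 is assumed to have rank at most r (for arbitrary X^0 the stated bound can fail at k=1), and the second claim is stated for positive ε̃_r, since k* is undefined when ε̃_r=0. *)

theory Defs
  imports "HOL-Analysis.Analysis"
begin

text \<open>
  Matrices in R^(m x n) are elements of \<^typ>\<open>real^'n^'m\<close>. On this type the library's
  inner product is Tr(X^T Y) and the library's \<^const>\<open>norm\<close> is the Frobenius norm.
\<close>

lemma inner_matrix_eq_trace:
  fixes X Y :: "real^'n^'m"
  shows "X \<bullet> Y = trace (transpose X ** Y)"
proof -
  have "X \<bullet> Y = (\<Sum>i\<in>UNIV. \<Sum>j\<in>UNIV. X $ i $ j * Y $ i $ j)"
    by (simp add: inner_vec_def)
  also have "\<dots> = (\<Sum>j\<in>UNIV. \<Sum>i\<in>UNIV. X $ i $ j * Y $ i $ j)"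
    by (rule sum.swap)
  also have "\<dots> = trace (transpose X ** Y)"
    by (simp add: trace_def transpose_def matrix_matrix_mult_def)
  finally show ?thesis .
qed

lemma norm_matrix_eq_frobenius:
  fixes X :: "real^'n^'m"
  shows "norm X = sqrt (\<Sum>i\<in>UNIV. \<Sum>j\<in>UNIV. (X $ i $ j)\<^sup>2)"
  by (simp add: norm_eq_sqrt_inner inner_vec_def power2_eq_square)

definition outer_product :: "real^'m \<Rightarrow> real^'n \<Rightarrow> real^'n^'m" where
  "outer_product u v = (\<chi> i j. u $ i * v $ j)"

text \<open>
  Singular value decomposition X = sum over i = 1..m of sigma_i u_i v_i^T, for m <= n.
  The values of \<open>\<sigma>\<close>, \<open>u\<close>, \<open>v\<close> outside the index range 1..m are irrelevant.
\<close>

definition is_svd ::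
  "real^'n^'m \<Rightarrow> (nat \<Rightarrow> real) \<Rightarrow> (nat \<Rightarrow> real^'m) \<Rightarrow> (nat \<Rightarrow> real^'n) \<Rightarrow> bool" where
  "is_svd X \<sigma> u v \<longleftrightarrow>
     (\<forall>i\<in>{1..CARD('m)}. \<forall>j\<in>{1..CARD('m)}. u i \<bullet> u j = (if i = j then 1 else 0)) \<and>
     (\<forall>i\<in>{1..CARD('m)}. \<forall>j\<in>{1..CARD('m)}. v i \<bullet> v j = (if i = j then 1 else 0)) \<and>
     (\<forall>i\<in>{1..CARD('m)}. 0 \<le> \<sigma> i) \<and>
     (\<forall>i\<in>{1..CARD('m)}. \<forall>j\<in>{1..CARD('m)}. i \<le> j \<longrightarrow> \<sigma> j \<le> \<sigma> i) \<and>
     X = (\<Sum>i = 1..CARD('m). \<sigma> i *\<^sub>R outer_product (u i) (v i))"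

text \<open>
  The singular values of a matrix do not depend on the chosen decomposition, so the choice
  operator below merely names them (on the index range 1..m).
\<close>

definition singular_values :: "real^'n^'m \<Rightarrow> nat \<Rightarrow> real" where
  "singular_values X = (SOME \<sigma>. \<exists>u v. is_svd X \<sigma> u v)"

definition nuclear_norm :: "real^'n^'m \<Rightarrow> real" where
  "nuclear_norm X = (\<Sum>i = 1..CARD('m). singular_values X i)"

text \<open>
  If sigma_r = sigma_(r+1) > 0, then R_r(X) depends on the decomposition. It is therefore
  modelled as the set of all admissible truncations; no tie-breaking rule is imposed.
\<close>

definition best_rank_approx :: "nat \<Rightarrow> real^'n^'m \<Rightarrow> (real^'n^'m) set" where
  "best_rank_approx r X =
     {Z. \<exists>\<sigma> u v. is_svd X \<sigma> u v \<and> Z = (\<Sum>i = 1..r. \<sigma> i *\<^sub>R outer_product (u i) (v i))}"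

definition restricted_isometry_constant :: "nat \<Rightarrow> (real^'n^'m \<Rightarrow> real^'p) \<Rightarrow> real" where
  "restricted_isometry_constant s \<A> =
     (LEAST \<delta>. \<forall>X. rank X \<le> s \<longrightarrow>
        (1 - \<delta>) * (norm X)\<^sup>2 \<le> (norm (\<A> X))\<^sup>2 \<and> (norm (\<A> X))\<^sup>2 \<le> (1 + \<delta>) * (norm X)\<^sup>2)"

text \<open>The least constant exists, so the description in the definition is not vacuous.\<close>

lemma restricted_isometry_constant_attained:
  fixes \<A> :: "real^'n^'m \<Rightarrow> real^'p"
  assumes "linear \<A>" and "1 \<le> s" and "rank X \<le> s"
  shows "(1 - restricted_isometry_constant s \<A>) * (norm X)\<^sup>2 \<le> (norm (\<A> X))\<^sup>2"
    and "(norm (\<A> X))\<^sup>2 \<le> (1 + restricted_isometry_constant s \<A>) * (norm X)\<^sup>2"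
proof -
  define P where "P = (\<lambda>\<delta>. \<forall>X. rank X \<le> s \<longrightarrow>
     (1 - \<delta>) * (norm X)\<^sup>2 \<le> (norm (\<A> X))\<^sup>2 \<and> (norm (\<A> X))\<^sup>2 \<le> (1 + \<delta>) * (norm X)\<^sup>2)"
  obtain B where B: "\<And>X. norm (\<A> X) \<le> B * norm X" and "0 < B"
    using linear_bounded_pos[OF assms(1)] by blast
  have "P (1 + B\<^sup>2)"
    unfolding P_def
  proof (intro allI impI conjI)
    fix X :: "real^'n^'m"
    have "(norm (\<A> X))\<^sup>2 \<le> (B * norm X)\<^sup>2" using B by (intro power_mono) auto
    then have 1: "(norm (\<A> X))\<^sup>2 \<le> B\<^sup>2 * (norm X)\<^sup>2" by (simp add: power_mult_distrib)
    have "0 \<le> B\<^sup>2 * (norm X)\<^sup>2" by simp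
    then show "(1 - (1 + B\<^sup>2)) * (norm X)\<^sup>2 \<le> (norm (\<A> X))\<^sup>2"
      using zero_le_power2[of "norm (\<A> X)"] by (simp only: left_diff_distrib distrib_right)
    have "0 \<le> (norm X)\<^sup>2" by simp
    then show "(norm (\<A> X))\<^sup>2 \<le> (1 + (1 + B\<^sup>2)) * (norm X)\<^sup>2"
      using 1 by (simp only: distrib_right)
  qed
  then have ne: "Collect P \<noteq> {}" by blast
  define E where "E = (\<chi> (i::'m) (j::'n). if i = undefined \<and> j = undefined then 1 else (0::real))"
  have "rows E \<subseteq> span {axis undefined 1 :: real^'n}"
  proof
    fix x assume "x \<in> rows E"
    then obtain i where x: "x = (\<chi> j. E $ i $ j)" by (auto simp: rows_def row_def)
    have "x = (if i = undefined then 1 else 0) *\<^sub>R axis undefined 1"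
      by (auto simp: x E_def vec_eq_iff axis_def)
    then show "x \<in> span {axis undefined 1}" by (metis span_base span_scale singletonI)
  qed
  then have "rank E \<le> 1"
    unfolding row_rank_def using dim_le_card[of "rows E" "{axis undefined 1 :: real^'n}"] by simp
  then have rankE: "rank E \<le> s" using assms(2) by simp
  have "E \<noteq> 0"
  proof
    assume "E = 0"
    then have "E $ undefined $ undefined = 0" by simp
    then show False by (simp add: E_def)
  qed
  then have normE: "0 < (norm E)\<^sup>2" by simp
  have bdd: "bdd_below (Collect P)"
  proof (rule bdd_belowI)
    fix \<delta> assume "\<delta> \<in> Collect P"
    then have "(1 - \<delta>) * (norm E)\<^sup>2 \<le> (1 + \<delta>) * (norm E)\<^sup>2"
      using rankE unfolding P_def by force
    then have "1 - \<delta> \<le> 1 + \<delta>" using normE by (simp only: mult_le_cancel_right_pos)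
    then show "0 \<le> \<delta>" by simp
  qed
  have "closed (Collect P)"
    unfolding P_def
    by (intro closed_Collect_all closed_Collect_imp closed_Collect_conj closed_Collect_le
          continuous_intros) auto
  then have "Inf (Collect P) \<in> Collect P"
    by (rule closed_contains_Inf[OF ne bdd])
  then have least: "(LEAST \<delta>. P \<delta>) = Inf (Collect P)"
    by (intro Least_equality) (auto intro: cInf_lower bdd)
  then have "restricted_isometry_constant s \<A> = Inf (Collect P)"
    unfolding restricted_isometry_constant_def P_def by simp
  then have "P (restricted_isometry_constant s \<A>)"
    using \<open>Inf (Collect P) \<in> Collect P\<close> by simp
  then show "(1 - restricted_isometry_constant s \<A>) * (norm X)\<^sup>2 \<le> (norm (\<A> X))\<^sup>2"
    and "(norm (\<A> X))\<^sup>2 \<le> (1 + restricted_isometry_constant s \<A>) * (norm X)\<^sup>2"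
    using assms(3) unfolding P_def by blast+
qed

text \<open>
  \<open>x\<close> is a possible sequence of IHT iterates; since hard thresholding is set-valued, several
  sequences may be possible for the same data.
\<close>

definition IHT_iterates ::
  "(real^'n^'m \<Rightarrow> real^'p) \<Rightarrow> real^'p \<Rightarrow> nat \<Rightarrow> real^'n^'m \<Rightarrow> (nat \<Rightarrow> real^'n^'m) \<Rightarrow> bool" where
  "IHT_iterates \<A> b r X0 x \<longleftrightarrow>
     x 0 = X0 \<and>
     (\<forall>k. x (Suc k) \<in> best_rank_approx r (x k - adjoint \<A> (\<A> (x k) - b)))"

end

theory Submission
  imports Defs
begin

text \<open>
  Write \<open>b = A Xr + e'\<close> with \<open>e' = A (X - Xr) + e\<close>. The thresholded matrix \<open>x (k+1)\<close> is at least
  as close to the gradient step \<open>Y\<close> as \<open>Xr\<close> is (Eckart--Young), so \<open>D' = x (k+1) - Xr\<close> and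
  \<open>D = x k - Xr\<close> satisfy \<open>|D'|^2 \<le> 2 (D \<bullet> D' - A D \<bullet> A D') + 2 e' \<bullet> A D'\<close>. All combinations of
  \<open>D\<close> and \<open>D'\<close> have rank at most \<open>3r\<close>, so polarisation of the restricted isometry property bounds
  the first term by \<open>2 \<delta> |D| |D'|\<close>. With \<open>\<delta> = \<alpha> / sqrt 8\<close>, so that \<open>2 \<delta> \<le> \<alpha>\<close>, this gives the
  contraction \<open>|D'| \<le> \<alpha> |D| + \<beta> |e'|\<close>. Cutting the singular values of \<open>X - Xr\<close> into blocks of
  length \<open>r\<close> gives \<open>|e'| \<le> (\<beta>/2) \<epsilon>\<close>.
\<close>

section \<open>Outer products and rank\<close>

lemma inner_outer_product:
  fixes u u' :: "real^'m" and v v' :: "real^'n"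
  shows "outer_product u v \<bullet> outer_product u' v' = (u \<bullet> u') * (v \<bullet> v')"
  by (simp add: outer_product_def inner_vec_def sum_product algebra_simps)

text \<open>Here \<open>b v* Y\<close> is the transpose of \<open>Y\<close> applied to
  \<open>b\<close>. Pairing \<open>Y\<close> with a sum of outer products thus becomes a sum of
  vector inner products, the form needed for Eckart--Young.\<close>

lemma inner_outer_product_right:
  fixes Y :: "real^'n^'m"
  shows "Y \<bullet> outer_product b w = (b v* Y) \<bullet> w"
proof -
  have "Y \<bullet> outer_product b w = (\<Sum>i\<in>UNIV. \<Sum>j\<in>UNIV. Y $ i $ j * (b $ i * w $ j))"
    by (simp add: outer_product_def inner_vec_def)
  also have "\<dots> = (\<Sum>j\<in>UNIV. \<Sum>i\<in>UNIV. Y $ i $ j * (b $ i * w $ j))"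
    by (rule sum.swap)
  also have "\<dots> = (b v* Y) \<bullet> w"
    by (simp add: vector_matrix_mult_def inner_vec_def sum_distrib_left sum_distrib_right ac_simps)
  finally show ?thesis .
qed

lemma rank_outer_product_le: "rank (outer_product u v :: real^'n^'m) \<le> 1"
proof -
  have "rows (outer_product u v :: real^'n^'m) \<subseteq> span {v}"
  proof
    fix y assume "y \<in> rows (outer_product u v :: real^'n^'m)"
    then obtain i where "y = u $ i *\<^sub>R v"
      by (auto simp: rows_def row_def outer_product_def vec_eq_iff)
    then show "y \<in> span {v}" by (simp add: span_base span_scale)
  qed
  then show ?thesis
    unfolding row_rank_def using dim_le_card[of _ "{v}"] by fastforce
qed

text \<open>Every row of \<open>A + B\<close> lies in the sum of the two row spaces, and the
  dimension of a sum of subspaces is at most the sum of their dimensions.\<close>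

lemma rank_add_le:
  fixes A B :: "real^'n^'m"
  shows "rank (A + B) \<le> rank A + rank B"
proof -
  let ?S = "{x + y |x y. x \<in> span (rows A) \<and> y \<in> span (rows B)}"
  have "rows (A + B) \<subseteq> ?S"
  proof
    fix y assume "y \<in> rows (A + B)"
    then obtain i where "y = row i A + row i B"
      by (auto simp: rows_def row_def vec_eq_iff)
    moreover have "row i A \<in> span (rows A)" "row i B \<in> span (rows B)"
      by (auto intro!: span_base simp: rows_def)
    ultimately show "y \<in> ?S" by blast
  qed
  then have "dim (rows (A + B)) \<le> dim ?S" by (rule dim_subset)
  also have "\<dots> \<le> dim (span (rows A)) + dim (span (rows B))"
    using dim_sums_Int[of "span (rows A)" "span (rows B)"] by simp
  finally show ?thesis by (simp add: row_rank_def)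
qed

lemma rank_scaleR_le:
  fixes A :: "real^'n^'m"
  shows "rank (c *\<^sub>R A) \<le> rank A"
proof -
  have "rows (c *\<^sub>R A) \<subseteq> span (rows A)"
  proof
    fix y assume "y \<in> rows (c *\<^sub>R A)"
    then obtain i where "y = c *\<^sub>R row i A"
      by (auto simp: rows_def row_def vec_eq_iff)
    moreover have "row i A \<in> span (rows A)" by (auto intro!: span_base simp: rows_def)
    ultimately show "y \<in> span (rows A)" by (simp add: span_scale)
  qed
  then show ?thesis
    using dim_subset[of "rows (c *\<^sub>R A)" "span (rows A)"] by (simp add: row_rank_def)
qed

lemma rank_sum_outer_product_le:
  assumes "finite S"
  shows "rank (\<Sum>i\<in>S. \<sigma> i *\<^sub>R outer_product (u i) (v i) :: real^'n^'m) \<le> card S"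
  using assms
proof (induction S)
  case empty
  then show ?case by simp
next
  case (insert a S)
  have "rank (\<sigma> a *\<^sub>R outer_product (u a) (v a) :: real^'n^'m) \<le> 1"
    using rank_scaleR_le rank_outer_product_le order_trans by blast
  then show ?case
    using insert rank_add_le[of "\<sigma> a *\<^sub>R outer_product (u a) (v a) :: real^'n^'m"
        "\<Sum>i\<in>S. \<sigma> i *\<^sub>R outer_product (u i) (v i)"]
    by simp
qed

section \<open>Orthonormal families\<close>

lemma norm_sum_orthonormal:
  fixes w :: "'i \<Rightarrow> 'a::real_inner"
  assumes "finite S" and "\<And>i j. i \<in> S \<Longrightarrow> j \<in> S \<Longrightarrow> w i \<bullet> w j = (if i = j then 1 else 0)"
  shows "(norm (\<Sum>i\<in>S. c i *\<^sub>R w i))\<^sup>2 = (\<Sum>i\<in>S. (c i)\<^sup>2)"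
proof -
  have "(norm (\<Sum>i\<in>S. c i *\<^sub>R w i))\<^sup>2 = (\<Sum>i\<in>S. \<Sum>j\<in>S. c i * c j * (w j \<bullet> w i))"
    by (simp add: power2_norm_eq_inner inner_sum_left inner_sum_right sum_distrib_left mult.assoc)
  also have "\<dots> = (\<Sum>i\<in>S. \<Sum>j\<in>S. if i = j then c i * c j else 0)"
    using assms(2) by (intro sum.cong refl) auto
  also have "\<dots> = (\<Sum>i\<in>S. (c i)\<^sup>2)"
    using assms(1) by (simp add: power2_eq_square)
  finally show ?thesis .
qed

text \<open>The gap between the two sides is the squared distance from \<open>y\<close> to its
  projection \<open>?p\<close> onto the span of the family.\<close>

lemma Bessel_inequality:
  fixes w :: "'i \<Rightarrow> 'a::real_inner"
  assumes "finite S" and "\<And>i j. i \<in> S \<Longrightarrow> j \<in> S \<Longrightarrow> w i \<bullet> w j = (if i = j then 1 else 0)"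
  shows "(\<Sum>i\<in>S. (y \<bullet> w i)\<^sup>2) \<le> (norm y)\<^sup>2"
proof -
  let ?p = "\<Sum>i\<in>S. (y \<bullet> w i) *\<^sub>R w i"
  have "0 \<le> (norm (y - ?p))\<^sup>2" by simp
  also have "\<dots> = (norm y)\<^sup>2 - 2 * (y \<bullet> ?p) + (norm ?p)\<^sup>2"
    by (simp add: power2_norm_eq_inner inner_diff_left inner_diff_right inner_commute)
  also have "y \<bullet> ?p = (\<Sum>i\<in>S. (y \<bullet> w i)\<^sup>2)"
    by (simp add: inner_sum_right power2_eq_square)
  also have "(norm ?p)\<^sup>2 = (\<Sum>i\<in>S. (y \<bullet> w i)\<^sup>2)"
    by (rule norm_sum_orthonormal[OF assms])
  finally show ?thesis by simp
qed

text \<open>\<open>B\<close> is an orthonormal basis of the column space. The sum on the right is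
  the orthogonal projection onto that space applied to \<open>W\<close>, which fixes every column of
  \<open>W\<close>.\<close>

lemma rank_decomposition:
  fixes W :: "real^'n^'m"
  obtains B where "finite B" and "card B = rank W"
    and "\<And>b c. b \<in> B \<Longrightarrow> c \<in> B \<Longrightarrow> b \<bullet> c = (if b = c then 1 else 0)"
    and "W = (\<Sum>b\<in>B. outer_product b (b v* W))"
proof -
  obtain B where B: "B \<subseteq> span (columns W)" "pairwise orthogonal B"
    "\<And>x. x \<in> B \<Longrightarrow> norm x = 1" "independent B" "card B = dim (span (columns W))"
    "span B = span (columns W)"
    using orthonormal_basis_subspace[OF subspace_span[of "columns W"]] by metis
  have fin: "finite B" using B(4) by (rule independent_imp_finite)
  have on: "b \<bullet> c = (if b = c then 1 else 0)" if "b \<in> B" "c \<in> B" for b c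
    using that B(2) B(3)[of b] by (auto simp: pairwise_def orthogonal_def norm_eq_1)
  have "W $ i $ j = (\<Sum>b\<in>B. outer_product b (b v* W)) $ i $ j" for i j
  proof -
    have "column j W \<in> span B"
      unfolding B(6) by (auto intro!: span_base simp: columns_def)
    then obtain f where f: "column j W = (\<Sum>b\<in>B. f b *\<^sub>R b)"
      using span_finite[OF fin] by auto
    \<comment> \<open>By orthonormality the coefficient of column \<open>j\<close> at
      \<open>b\<close> is its inner product with \<open>b\<close>, which is entry \<open>j\<close>
      of \<open>b v* W\<close>.\<close>
    have fb: "(b v* W) $ j = f b" if "b \<in> B" for b
    proof -
      have "(b v* W) $ j = b \<bullet> column j W"
        by (simp add: vector_matrix_mult_def column_def inner_vec_def mult.commute)
      also have "\<dots> = (\<Sum>c\<in>B. if b = c then f c else 0)"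
        unfolding f inner_sum_right using on[OF that] by (intro sum.cong) auto
      also have "\<dots> = f b" using fin that by simp
      finally show ?thesis .
    qed
    have "W $ i $ j = column j W $ i" by (simp add: column_def)
    also have "\<dots> = (\<Sum>b\<in>B. f b * b $ i)" unfolding f by simp
    also have "\<dots> = (\<Sum>b\<in>B. outer_product b (b v* W)) $ i $ j"
      by (simp add: outer_product_def fb mult.commute)
    finally show ?thesis .
  qed
  then have "W = (\<Sum>b\<in>B. outer_product b (b v* W))" by (simp add: vec_eq_iff)
  moreover have "card B = rank W" using B(5) by (simp add: column_rank_def)
  ultimately show ?thesis using that fin on by blast
qed

section \<open>Singular value decompositions\<close>

text \<open>The outer products of matching singular vectors are orthonormal for the Frobenius inner
  product, so this is Pythagoras.\<close>

lemma is_svd_norm_sum: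
  fixes X :: "real^'n^'m"
  assumes "is_svd X \<sigma> u v" and "S \<subseteq> {1..CARD('m)}"
  shows "(norm (\<Sum>i\<in>S. \<sigma> i *\<^sub>R outer_product (u i) (v i)))\<^sup>2 = (\<Sum>i\<in>S. (\<sigma> i)\<^sup>2)"
proof (rule norm_sum_orthonormal)
  show "finite S" using assms(2) by (rule finite_subset) simp
next
  fix i j assume "i \<in> S" "j \<in> S"
  then show "outer_product (u i) (v i) \<bullet> outer_product (u j) (v j) = (if i = j then 1 else 0)"
    using assms unfolding is_svd_def inner_outer_product by (auto simp: subset_iff)
qed

lemma is_svd_truncation_diff:
  fixes X :: "real^'n^'m"
  assumes "is_svd X \<sigma> u v" and "r \<le> CARD('m)"
  shows "X - (\<Sum>i = 1..r. \<sigma> i *\<^sub>R outer_product (u i) (v i)) =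
         (\<Sum>i\<in>{r<..CARD('m)}. \<sigma> i *\<^sub>R outer_product (u i) (v i))"
proof -
  have "{1..CARD('m)} = {1..r} \<union> {r<..CARD('m)}" using assms(2) by auto
  moreover have "X = (\<Sum>i\<in>{1..CARD('m)}. \<sigma> i *\<^sub>R outer_product (u i) (v i))"
    using assms(1) by (simp add: is_svd_def)
  ultimately have "X = (\<Sum>i = 1..r. \<sigma> i *\<^sub>R outer_product (u i) (v i)) +
      (\<Sum>i\<in>{r<..CARD('m)}. \<sigma> i *\<^sub>R outer_product (u i) (v i))"
    by (simp only:) (rule sum.union_disjoint, auto)
  then show ?thesis by simp
qed

text \<open>
  Cyclically shifting the indices by \<open>r\<close> turns a decomposition of \<open>X\<close> into one of the tail, so no
  general existence theorem for singular value decompositions is required.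
\<close>

lemma is_svd_tail:
  fixes X :: "real^'n^'m"
  assumes svd: "is_svd X \<sigma> u v" and r: "r \<le> CARD('m)"
    and Z: "Z = (\<Sum>i = 1..r. \<sigma> i *\<^sub>R outer_product (u i) (v i))"
  shows "\<exists>\<sigma>' u' v'. is_svd (X - Z) \<sigma>' u' v'"
proof -
  let ?m = "CARD('m)"
  define p where "p i = (if i \<le> ?m - r then i + r else i - (?m - r))" for i
  \<comment> \<open>The wrapped-around vectors only fill the orthonormal families up to length
    \<open>?m\<close>. Their coefficient is 0, which keeps the order decreasing because all singular
    values are nonnegative.\<close>
  define \<sigma>' where "\<sigma>' i = (if i \<le> ?m - r then \<sigma> (i + r) else 0)" for i
  have p: "p i \<in> {1..?m}" if "i \<in> {1..?m}" for i
    using that r by (auto simp: p_def)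
  have inj: "p i = p j \<longleftrightarrow> i = j" if "i \<in> {1..?m}" "j \<in> {1..?m}" for i j
    using that r by (auto simp: p_def split: if_splits)
  have "X - Z = (\<Sum>i\<in>{r<..?m}. \<sigma> i *\<^sub>R outer_product (u i) (v i))"
    unfolding Z by (rule is_svd_truncation_diff[OF svd r])
  also have "\<dots> = (\<Sum>i\<in>{1..?m - r}. \<sigma> (i + r) *\<^sub>R outer_product (u (i + r)) (v (i + r)))"
    by (rule sum.reindex_bij_witness[of _ "\<lambda>i. i + r" "\<lambda>i. i - r"]) auto
  also have "\<dots> = (\<Sum>i\<in>{1..?m - r}. \<sigma>' i *\<^sub>R outer_product (u (p i)) (v (p i)))"
    by (intro sum.cong refl) (auto simp: \<sigma>'_def p_def)
  also have "\<dots> = (\<Sum>i\<in>{1..?m}. \<sigma>' i *\<^sub>R outer_product (u (p i)) (v (p i)))"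
    by (rule sum.mono_neutral_left) (auto simp: \<sigma>'_def)
  finally have eq: "X - Z = (\<Sum>i\<in>{1..?m}. \<sigma>' i *\<^sub>R outer_product (u (p i)) (v (p i)))" .
  have nonneg: "0 \<le> \<sigma> i" if "i \<in> {1..?m}" for i using svd that by (simp add: is_svd_def)
  have dec: "\<sigma> j \<le> \<sigma> i" if "i \<in> {1..?m}" "j \<in> {1..?m}" "i \<le> j" for i j
    using svd that by (simp add: is_svd_def)
  have "is_svd (X - Z) \<sigma>' (u \<circ> p) (v \<circ> p)"
    unfolding is_svd_def
  proof (intro conjI ballI impI)
    fix i j assume ij: "i \<in> {1..?m}" "j \<in> {1..?m}"
    show "(u \<circ> p) i \<bullet> (u \<circ> p) j = (if i = j then 1 else 0)"
      using svd p[OF ij(1)] p[OF ij(2)] inj[OF ij] unfolding is_svd_def by simp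
    show "(v \<circ> p) i \<bullet> (v \<circ> p) j = (if i = j then 1 else 0)"
      using svd p[OF ij(1)] p[OF ij(2)] inj[OF ij] unfolding is_svd_def by simp
    show "0 \<le> \<sigma>' i" using ij r by (auto simp: \<sigma>'_def intro!: nonneg)
    assume "i \<le> j"
    then show "\<sigma>' j \<le> \<sigma>' i" using ij r by (auto simp: \<sigma>'_def intro!: nonneg dec)
  qed (simp add: eq)
  then show ?thesis by blast
qed

text \<open>Every entry is compared with \<open>a r\<close>: moving weight to the first
  \<open>r\<close> indices never lowers the sum. The difference of the two sides is at most
  \<open>a r\<close> times the excess of the total weight over \<open>r\<close>, which is not
  positive.\<close>

lemma weighted_sum_le_top:
  fixes a p :: "nat \<Rightarrow> real"
  assumes "1 \<le> r" and "r \<le> m"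
    and nonneg: "\<And>i. i \<in> {1..m} \<Longrightarrow> 0 \<le> a i"
    and dec: "\<And>i j. i \<in> {1..m} \<Longrightarrow> j \<in> {1..m} \<Longrightarrow> i \<le> j \<Longrightarrow> a j \<le> a i"
    and p: "\<And>i. i \<in> {1..m} \<Longrightarrow> 0 \<le> p i \<and> p i \<le> 1"
    and sum_p: "(\<Sum>i\<in>{1..m}. p i) \<le> real r"
  shows "(\<Sum>i\<in>{1..m}. a i * p i) \<le> (\<Sum>i\<in>{1..r}. a i)"
proof -
  have un: "{1..m} = {1..r} \<union> {r<..m}" using assms(1,2) by auto
  have split: "(\<Sum>i\<in>{1..m}. f i) = (\<Sum>i\<in>{1..r}. f i) + (\<Sum>i\<in>{r<..m}. f i)" for f :: "nat \<Rightarrow> real"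
    unfolding un by (rule sum.union_disjoint) auto
  have "(\<Sum>i\<in>{1..r}. a i * (p i - 1)) \<le> (\<Sum>i\<in>{1..r}. a r * (p i - 1))"
    using assms(1,2) p by (intro sum_mono mult_right_mono_neg dec) auto
  moreover have "(\<Sum>i\<in>{r<..m}. a i * p i) \<le> (\<Sum>i\<in>{r<..m}. a r * p i)"
    using assms(1,2) p by (intro sum_mono mult_right_mono dec) auto
  moreover have "(\<Sum>i\<in>{1..r}. a r * (p i - 1)) + (\<Sum>i\<in>{r<..m}. a r * p i) =
      a r * ((\<Sum>i\<in>{1..m}. p i) - real r)"
    unfolding split by (simp add: sum_subtractf sum_distrib_left[symmetric] algebra_simps)
  moreover have "a r * ((\<Sum>i\<in>{1..m}. p i) - real r) \<le> 0"
    using sum_p nonneg[of r] assms(1,2) by (intro mult_nonneg_nonpos) auto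
  moreover have "(\<Sum>i\<in>{1..r}. a i * (p i - 1)) = (\<Sum>i\<in>{1..r}. a i * p i) - (\<Sum>i\<in>{1..r}. a i)"
    by (simp add: sum_subtractf algebra_simps)
  ultimately show ?thesis unfolding split by linarith
qed

text \<open>Among matrices with columns in span \<open>B\<close>, the projection of \<open>Y\<close>
  is closest to \<open>Y\<close>. It captures a weighted sum of the squared singular values, with
  weights in [0,1] of total at most \<open>r\<close>, hence no more than the top \<open>r\<close> of
  them. The argument works for whichever decomposition produced \<open>Z\<close>, so ties are
  harmless.\<close>

theorem Eckart_Young_Frobenius:
  fixes Y W Z :: "real^'n^'m"
  assumes Z: "Z \<in> best_rank_approx r Y" and r: "1 \<le> r" "r \<le> CARD('m)" and W: "rank W \<le> r"
  shows "norm (Y - Z) \<le> norm (Y - W)"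
proof -
  let ?I = "{1..CARD('m)}"
  obtain \<sigma> u v where svd: "is_svd Y \<sigma> u v"
    and Zeq: "Z = (\<Sum>i = 1..r. \<sigma> i *\<^sub>R outer_product (u i) (v i))"
    using Z unfolding best_rank_approx_def by blast
  have u: "u i \<bullet> u j = (if i = j then 1 else 0)" and v: "v i \<bullet> v j = (if i = j then 1 else 0)"
    and nonneg: "0 \<le> \<sigma> i" and dec: "i \<le> j \<Longrightarrow> \<sigma> j \<le> \<sigma> i"
    if "i \<in> ?I" "j \<in> ?I" for i j
    using svd that unfolding is_svd_def by blast+
  have Y: "Y = (\<Sum>i\<in>?I. \<sigma> i *\<^sub>R outer_product (u i) (v i))"
    using svd by (simp add: is_svd_def)
  have normY: "(norm Y)\<^sup>2 = (\<Sum>i\<in>?I. (\<sigma> i)\<^sup>2)"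
    using is_svd_norm_sum[OF svd order_refl] Y by simp
  have normYZ: "(norm (Y - Z))\<^sup>2 = (\<Sum>i\<in>{r<..CARD('m)}. (\<sigma> i)\<^sup>2)"
    unfolding Zeq is_svd_truncation_diff[OF svd r(2)]
    by (rule is_svd_norm_sum[OF svd]) auto
  obtain B where fin: "finite B" and card: "card B = rank W"
    and B: "\<And>b c. b \<in> B \<Longrightarrow> c \<in> B \<Longrightarrow> b \<bullet> c = (if b = c then 1 else 0)"
    and Weq: "W = (\<Sum>b\<in>B. outer_product b (b v* W))"
    using rank_decomposition[of W] by blast
  have YW: "Y \<bullet> W = (\<Sum>b\<in>B. (b v* Y) \<bullet> (b v* W))"
    by (subst Weq) (simp add: inner_sum_right inner_outer_product_right)
  have WW: "W \<bullet> W = (\<Sum>b\<in>B. (b v* W) \<bullet> (b v* W))"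
  proof -
    have "W \<bullet> W = W \<bullet> (\<Sum>b\<in>B. outer_product b (b v* W))"
      by (rule arg_cong[OF Weq])
    also have "\<dots> = (\<Sum>b\<in>B. (b v* W) \<bullet> (b v* W))"
      by (simp add: inner_sum_right inner_outer_product_right)
    finally show ?thesis .
  qed
  \<comment> \<open>Completing the square: the slack is the sum of the squared norms of
    \<open>b v* Y - b v* W\<close>.\<close>
  have normYW: "(norm (Y - W))\<^sup>2 \<ge> (norm Y)\<^sup>2 - (\<Sum>b\<in>B. (norm (b v* Y))\<^sup>2)"
  proof -
    have "(norm (Y - W))\<^sup>2 = (norm Y)\<^sup>2 - 2 * (Y \<bullet> W) + W \<bullet> W"
      by (simp add: power2_norm_eq_inner inner_diff_left inner_diff_right inner_commute)
    moreover have "0 \<le> (\<Sum>b\<in>B. (norm (b v* Y - b v* W))\<^sup>2)" by (intro sum_nonneg) simp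
    moreover have "(\<Sum>b\<in>B. (norm (b v* Y - b v* W))\<^sup>2) =
        (\<Sum>b\<in>B. (norm (b v* Y))\<^sup>2) - 2 * (Y \<bullet> W) + W \<bullet> W"
      unfolding YW WW
      by (simp add: power2_norm_eq_inner inner_diff_left inner_diff_right inner_commute
          sum.distrib sum_subtractf sum_distrib_left)
    ultimately show ?thesis by linarith
  qed
  \<comment> \<open>The expansion of \<open>b v* Y\<close> in the right singular vectors is found by
    testing against every \<open>y\<close>; its squared norm then follows from
    orthonormality.\<close>
  have bY: "(norm (b v* Y))\<^sup>2 = (\<Sum>i\<in>?I. (\<sigma> i)\<^sup>2 * (u i \<bullet> b)\<^sup>2)" for b
  proof -
    have "y \<bullet> (b v* Y) = y \<bullet> (\<Sum>i\<in>?I. (\<sigma> i * (u i \<bullet> b)) *\<^sub>R v i)" for y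
    proof -
      have "y \<bullet> (b v* Y) = Y \<bullet> outer_product b y"
        by (simp add: inner_outer_product_right inner_commute)
      also have "\<dots> = y \<bullet> (\<Sum>i\<in>?I. (\<sigma> i * (u i \<bullet> b)) *\<^sub>R v i)"
        by (subst Y) (simp add: inner_sum_left inner_sum_right inner_outer_product
            inner_commute mult.assoc)
      finally show ?thesis .
    qed
    then have "b v* Y = (\<Sum>i\<in>?I. (\<sigma> i * (u i \<bullet> b)) *\<^sub>R v i)"
      by (rule iffD1[OF vector_eq_ldot, OF allI])
    moreover have "(norm (\<Sum>i\<in>?I. (\<sigma> i * (u i \<bullet> b)) *\<^sub>R v i))\<^sup>2 = (\<Sum>i\<in>?I. (\<sigma> i * (u i \<bullet> b))\<^sup>2)"
      by (rule norm_sum_orthonormal) (use v in auto)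
    ultimately show ?thesis by (simp add: power_mult_distrib)
  qed
  \<comment> \<open>The squared length of the projection of \<open>u i\<close> onto span
    \<open>B\<close>. Bessel for \<open>B\<close> bounds each weight by 1; Bessel for the family
    \<open>u\<close>, summed over \<open>B\<close>, bounds the total by
    \<open>card B\<close>.\<close>
  define p where "p i = (\<Sum>b\<in>B. (u i \<bullet> b)\<^sup>2)" for i
  have "(\<Sum>b\<in>B. (norm (b v* Y))\<^sup>2) = (\<Sum>i\<in>?I. (\<sigma> i)\<^sup>2 * p i)"
    unfolding bY p_def sum_distrib_left by (rule sum.swap)
  also have "\<dots> \<le> (\<Sum>i\<in>{1..r}. (\<sigma> i)\<^sup>2)"
  proof (rule weighted_sum_le_top[OF r])
    fix i assume i: "i \<in> ?I"
    have "p i \<le> (norm (u i))\<^sup>2"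
      unfolding p_def using Bessel_inequality[OF fin, of "\<lambda>b. b"] B by blast
    then show "0 \<le> p i \<and> p i \<le> 1"
      using u[OF i i] by (simp add: p_def sum_nonneg power2_norm_eq_inner)
  next
    have "(\<Sum>i\<in>?I. p i) = (\<Sum>b\<in>B. \<Sum>i\<in>?I. (u i \<bullet> b)\<^sup>2)"
      unfolding p_def by (rule sum.swap)
    also have "\<dots> \<le> (\<Sum>b\<in>B. 1)"
    proof (rule sum_mono)
      fix b assume b: "b \<in> B"
      have "(\<Sum>i\<in>?I. (b \<bullet> u i)\<^sup>2) \<le> (norm b)\<^sup>2"
        by (rule Bessel_inequality) (use u in auto)
      then show "(\<Sum>i\<in>?I. (u i \<bullet> b)\<^sup>2) \<le> 1"
        using B[OF b b] by (simp add: power2_norm_eq_inner inner_commute)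
    qed
    finally show "(\<Sum>i\<in>?I. p i) \<le> real r" using card W by simp
  qed (use r in \<open>auto intro!: power_mono dec nonneg[of _ r]\<close>)
  also have "\<dots> = (norm Y)\<^sup>2 - (norm (Y - Z))\<^sup>2"
  proof -
    have "?I = {1..r} \<union> {r<..CARD('m)}" using r by auto
    then have "(\<Sum>i\<in>?I. (\<sigma> i)\<^sup>2) = (\<Sum>i\<in>{1..r}. (\<sigma> i)\<^sup>2) + (\<Sum>i\<in>{r<..CARD('m)}. (\<sigma> i)\<^sup>2)"
      by (simp only:) (rule sum.union_disjoint, auto)
    then show ?thesis unfolding normY normYZ by simp
  qed
  finally have "(norm (Y - Z))\<^sup>2 \<le> (norm (Y - W))\<^sup>2" using normYW by linarith
  then show ?thesis by (rule power2_le_imp_le) simp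
qed

lemma rank_best_rank_approx_le:
  assumes "Z \<in> best_rank_approx r X"
  shows "rank Z \<le> r"
  using assms rank_sum_outer_product_le[of "{1..r}"] unfolding best_rank_approx_def by fastforce

section \<open>Consequences of the restricted isometry property\<close>

text \<open>Polarisation. The isometry bounds are assumed only on the span of \<open>x\<close> and
  \<open>y\<close>, which lets the lemma apply to low-rank matrices.\<close>

lemma restricted_isometry_inner_le:
  fixes f :: "'a::real_inner \<Rightarrow> 'b::real_inner"
  assumes "linear f"
    and rip: "\<And>s t. (1 - \<delta>) * (norm (s *\<^sub>R x + t *\<^sub>R y))\<^sup>2 \<le> (norm (f (s *\<^sub>R x + t *\<^sub>R y)))\<^sup>2
      \<and> (norm (f (s *\<^sub>R x + t *\<^sub>R y)))\<^sup>2 \<le> (1 + \<delta>) * (norm (s *\<^sub>R x + t *\<^sub>R y))\<^sup>2"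
  shows "x \<bullet> y - f x \<bullet> f y \<le> \<delta> * norm x * norm y"
proof (cases "x = 0 \<or> y = 0")
  case True
  then show ?thesis using linear_0[OF assms(1)] by auto
next
  case False
  interpret f: linear f by fact
  \<comment> \<open>These weights give \<open>?s *\<^sub>R x\<close> and
    \<open>?t *\<^sub>R y\<close> equal length, so the error terms of the bounds for their sum and
    difference add up to exactly \<open>4 * \<delta> * ?s\<^sup>2 * ?t\<^sup>2\<close>.\<close>
  let ?s = "norm y" and ?t = "norm x"
  have lin: "f (s *\<^sub>R x + t *\<^sub>R y) = s *\<^sub>R f x + t *\<^sub>R f y" for s t
    by (simp add: f.add f.scaleR)
  have plus: "(norm (s *\<^sub>R z + t *\<^sub>R w))\<^sup>2 = s\<^sup>2 * (norm z)\<^sup>2 + 2 * s * t * (z \<bullet> w) + t\<^sup>2 * (norm w)\<^sup>2"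
    for s t and z w :: "'c::real_inner"
    unfolding power2_norm_eq_inner
    by (simp add: inner_add_left inner_add_right inner_commute power2_eq_square algebra_simps)
  have 1: "(1 - \<delta>) * (norm (?s *\<^sub>R x + ?t *\<^sub>R y))\<^sup>2 \<le> (norm (?s *\<^sub>R f x + ?t *\<^sub>R f y))\<^sup>2"
    using rip[of ?s ?t] unfolding lin by blast
  have 2: "(norm (?s *\<^sub>R f x + (- ?t) *\<^sub>R f y))\<^sup>2 \<le> (1 + \<delta>) * (norm (?s *\<^sub>R x + (- ?t) *\<^sub>R y))\<^sup>2"
    using rip[of ?s "- ?t"] unfolding lin by blast
  have "(4 * ?s * ?t) * (x \<bullet> y - f x \<bullet> f y) \<le> (4 * ?s * ?t) * (\<delta> * ?t * ?s)"
    using 1 2 unfolding plus by (simp add: algebra_simps power2_eq_square)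
  moreover have "0 < 4 * ?s * ?t" using False by simp
  ultimately show ?thesis by (simp only: mult_le_cancel_left_pos)
qed

text \<open>
  The sum is cut into consecutive blocks of length \<open>r\<close>; the root mean square of a block is at most
  its first entry, hence at most the mean of the preceding block.
\<close>

lemma norm_sum_tail_le:
  fixes g :: "nat \<Rightarrow> 'b::real_normed_vector" and \<sigma> :: "nat \<Rightarrow> real"
  assumes r: "1 \<le> r" and C: "0 \<le> C"
    and nonneg: "\<And>i. i \<in> {1..m} \<Longrightarrow> 0 \<le> \<sigma> i"
    and dec: "\<And>i j. i \<in> {1..m} \<Longrightarrow> j \<in> {1..m} \<Longrightarrow> i \<le> j \<Longrightarrow> \<sigma> j \<le> \<sigma> i"
    and g: "\<And>S. S \<subseteq> {1..m} \<Longrightarrow> card S \<le> r \<Longrightarrow> norm (\<Sum>i\<in>S. g i) \<le> C * sqrt (\<Sum>i\<in>S. (\<sigma> i)\<^sup>2)"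
    and \<tau>: "0 \<le> \<tau>" "\<And>i. i \<in> {q<..m} \<Longrightarrow> \<sigma> i \<le> \<tau>"
  shows "norm (\<Sum>i\<in>{q<..m}. g i) \<le> C * (sqrt r * \<tau> + (1 / sqrt r) * (\<Sum>i\<in>{q<..m}. \<sigma> i))"
  using \<tau>
\<comment> \<open>Induction on the number of remaining indices. The recursive call uses the cutoff
  \<open>q + r\<close> and, as the new bound \<tau>, the last entry \<open>\<sigma> (q + r)\<close>
  of the block just removed.\<close>
proof (induction "m - q" arbitrary: q \<tau> rule: less_induct)
  case less
  have sr: "0 < sqrt r" using r by simp
  have block: "norm (\<Sum>i\<in>S. g i) \<le> C * (sqrt r * \<tau>)" if S: "S \<subseteq> {q<..m}" "card S \<le> r" for S
  proof -
    have "(\<Sum>i\<in>S. (\<sigma> i)\<^sup>2) \<le> of_nat (card S) * \<tau>\<^sup>2"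
      using S less.prems by (intro sum_bounded_above power_mono nonneg) auto
    also have "\<dots> \<le> r * \<tau>\<^sup>2" using S by (intro mult_right_mono) auto
    finally have "sqrt (\<Sum>i\<in>S. (\<sigma> i)\<^sup>2) \<le> sqrt (r * \<tau>\<^sup>2)"
      by (rule real_sqrt_le_mono)
    also have "\<dots> = sqrt r * \<tau>" using less.prems(1) by (simp add: real_sqrt_mult)
    finally have "sqrt (\<Sum>i\<in>S. (\<sigma> i)\<^sup>2) \<le> sqrt r * \<tau>" .
    moreover have "norm (\<Sum>i\<in>S. g i) \<le> C * sqrt (\<Sum>i\<in>S. (\<sigma> i)\<^sup>2)"
      using S by (intro g) auto
    ultimately show ?thesis using C by (meson mult_left_mono order_trans)
  qed
  show ?case
  proof (cases "q + r < m")
    case False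
    have "norm (\<Sum>i\<in>{q<..m}. g i) \<le> C * (sqrt r * \<tau>)"
      using False by (intro block) auto
    also have "\<dots> \<le> C * (sqrt r * \<tau> + (1 / sqrt r) * (\<Sum>i\<in>{q<..m}. \<sigma> i))"
      using C by (intro mult_left_mono) (auto intro!: divide_nonneg_nonneg sum_nonneg nonneg)
    finally show ?thesis .
  next
    case True
    have un: "{q<..m} = {q<..q + r} \<union> {q + r<..m}" using True by auto
    have split: "sum f {q<..m} = sum f {q<..q + r} + sum f {q + r<..m}"
      for f :: "nat \<Rightarrow> 'c::comm_monoid_add"
      unfolding un by (rule sum.union_disjoint) auto
    have tail: "norm (\<Sum>i\<in>{q + r<..m}. g i) \<le>
        C * (sqrt r * \<sigma> (q + r) + (1 / sqrt r) * (\<Sum>i\<in>{q + r<..m}. \<sigma> i))"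
      using True r by (intro less.hyps nonneg dec) auto
    \<comment> \<open>The block has exactly \<open>r\<close> entries, none below its last one, so
      its sum pays for the term \<open>sqrt r * \<sigma> (q + r)\<close> charged by the
      rest.\<close>
    have "real (card {q<..q + r}) * \<sigma> (q + r) \<le> (\<Sum>i\<in>{q<..q + r}. \<sigma> i)"
      using True r by (intro sum_bounded_below dec) auto
    then have "sqrt r * (sqrt r * \<sigma> (q + r)) \<le> (\<Sum>i\<in>{q<..q + r}. \<sigma> i)"
      by (simp add: mult.assoc[symmetric])
    then have mean: "sqrt r * \<sigma> (q + r) \<le> (1 / sqrt r) * (\<Sum>i\<in>{q<..q + r}. \<sigma> i)"
      using sr by (simp add: pos_le_divide_eq mult.commute)
    have "norm (\<Sum>i\<in>{q<..m}. g i) \<le> norm (\<Sum>i\<in>{q<..q + r}. g i) + norm (\<Sum>i\<in>{q + r<..m}. g i)"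
      unfolding split by (rule norm_triangle_ineq)
    also have "\<dots> \<le> C * (sqrt r * \<tau>) +
        C * (sqrt r * \<sigma> (q + r) + (1 / sqrt r) * (\<Sum>i\<in>{q + r<..m}. \<sigma> i))"
      using True by (intro add_mono tail block) auto
    also have "\<dots> \<le> C * (sqrt r * \<tau>) +
        C * ((1 / sqrt r) * (\<Sum>i\<in>{q<..q + r}. \<sigma> i) + (1 / sqrt r) * (\<Sum>i\<in>{q + r<..m}. \<sigma> i))"
      using mean C by (intro add_left_mono mult_left_mono) auto
    also have "\<dots> = C * (sqrt r * \<tau> + (1 / sqrt r) * (\<Sum>i\<in>{q<..m}. \<sigma> i))"
      unfolding split by (simp add: algebra_simps add_divide_distrib)
    finally show ?thesis .
  qed
qed

text \<open>The first block has no predecessor and is charged to the Euclidean norm of \<sigma>. The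
  rest is covered by the tail estimate with \<open>\<sigma> r\<close> as \<tau>, and the mean of the
  first block absorbs that term.\<close>

lemma norm_sum_blocks_le:
  fixes g :: "nat \<Rightarrow> 'b::real_normed_vector" and \<sigma> :: "nat \<Rightarrow> real"
  assumes r: "1 \<le> r" "r \<le> m" and C: "0 \<le> C"
    and nonneg: "\<And>i. i \<in> {1..m} \<Longrightarrow> 0 \<le> \<sigma> i"
    and dec: "\<And>i j. i \<in> {1..m} \<Longrightarrow> j \<in> {1..m} \<Longrightarrow> i \<le> j \<Longrightarrow> \<sigma> j \<le> \<sigma> i"
    and g: "\<And>S. S \<subseteq> {1..m} \<Longrightarrow> card S \<le> r \<Longrightarrow> norm (\<Sum>i\<in>S. g i) \<le> C * sqrt (\<Sum>i\<in>S. (\<sigma> i)\<^sup>2)"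
  shows "norm (\<Sum>i\<in>{1..m}. g i) \<le>
    C * (sqrt (\<Sum>i\<in>{1..m}. (\<sigma> i)\<^sup>2) + (1 / sqrt r) * (\<Sum>i\<in>{1..m}. \<sigma> i))"
proof -
  have sr: "0 < sqrt r" using r by simp
  have un: "{1..m} = {1..r} \<union> {r<..m}" using r by auto
  have split: "sum f {1..m} = sum f {1..r} + sum f {r<..m}"
    for f :: "nat \<Rightarrow> 'c::comm_monoid_add"
    unfolding un by (rule sum.union_disjoint) auto
  have tail: "norm (\<Sum>i\<in>{r<..m}. g i) \<le>
      C * (sqrt r * \<sigma> r + (1 / sqrt r) * (\<Sum>i\<in>{r<..m}. \<sigma> i))"
    using r by (intro norm_sum_tail_le C nonneg dec g) auto
  have "real (card {1..r}) * \<sigma> r \<le> (\<Sum>i\<in>{1..r}. \<sigma> i)"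
    using r by (intro sum_bounded_below dec) auto
  then have "sqrt r * (sqrt r * \<sigma> r) \<le> (\<Sum>i\<in>{1..r}. \<sigma> i)"
    by (simp add: mult.assoc[symmetric])
  then have mean: "sqrt r * \<sigma> r \<le> (1 / sqrt r) * (\<Sum>i\<in>{1..r}. \<sigma> i)"
    using sr by (simp add: pos_le_divide_eq mult.commute)
  have "norm (\<Sum>i\<in>{1..r}. g i) \<le> C * sqrt (\<Sum>i\<in>{1..r}. (\<sigma> i)\<^sup>2)"
    using r by (intro g) auto
  also have "\<dots> \<le> C * sqrt (\<Sum>i\<in>{1..m}. (\<sigma> i)\<^sup>2)"
    using r C by (intro mult_left_mono real_sqrt_le_mono sum_mono2) auto
  finally have head: "norm (\<Sum>i\<in>{1..r}. g i) \<le> C * sqrt (\<Sum>i\<in>{1..m}. (\<sigma> i)\<^sup>2)" .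
  have "norm (\<Sum>i\<in>{1..m}. g i) \<le> norm (\<Sum>i\<in>{1..r}. g i) + norm (\<Sum>i\<in>{r<..m}. g i)"
    unfolding split by (rule norm_triangle_ineq)
  also have "\<dots> \<le> C * sqrt (\<Sum>i\<in>{1..m}. (\<sigma> i)\<^sup>2) +
      C * (sqrt r * \<sigma> r + (1 / sqrt r) * (\<Sum>i\<in>{r<..m}. \<sigma> i))"
    by (intro add_mono head tail)
  also have "\<dots> \<le> C * sqrt (\<Sum>i\<in>{1..m}. (\<sigma> i)\<^sup>2) +
      C * ((1 / sqrt r) * (\<Sum>i\<in>{1..r}. \<sigma> i) + (1 / sqrt r) * (\<Sum>i\<in>{r<..m}. \<sigma> i))"
    using mean C by (intro add_left_mono mult_left_mono) auto
  also have "\<dots> = C * (sqrt (\<Sum>i\<in>{1..m}. (\<sigma> i)\<^sup>2) + (1 / sqrt r) * (\<Sum>i\<in>{1..m}. \<sigma> i))"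
    unfolding split[of \<sigma>] by (simp add: algebra_simps add_divide_distrib)
  finally show ?thesis .
qed

text \<open>Extends a bound on matrices of rank at most \<open>r\<close> to any \<open>M\<close>:
  each block of at most \<open>r\<close> terms of a singular value decomposition has rank at most
  \<open>r\<close>.\<close>

lemma norm_linear_le_nuclear_norm:
  fixes \<A> :: "real^'n^'m \<Rightarrow> real^'p" and M :: "real^'n^'m"
  assumes "linear \<A>" and r: "1 \<le> r" "r \<le> CARD('m)" and C: "0 \<le> C"
    and A: "\<And>Z. rank Z \<le> r \<Longrightarrow> norm (\<A> Z) \<le> C * norm Z"
    and ex: "\<exists>\<sigma> u v. is_svd M \<sigma> u v"
  shows "norm (\<A> M) \<le> C * (norm M + 1 / sqrt r * nuclear_norm M)"
proof -
  interpret A: linear \<A> by fact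
  let ?m = "CARD('m)"
  define \<sigma> where "\<sigma> = singular_values M"
  \<comment> \<open>By \<open>ex\<close> the choice in \<open>singular_values\<close> is a genuine
    one, so \<open>M\<close> has a decomposition with exactly these coefficients.\<close>
  obtain u v where svd: "is_svd M \<sigma> u v"
    using someI_ex[OF ex] unfolding \<sigma>_def singular_values_def by blast
  define w where "w i = \<sigma> i *\<^sub>R outer_product (u i) (v i)" for i
  have M: "M = (\<Sum>i\<in>{1..?m}. w i)" using svd by (simp add: is_svd_def w_def)
  have norm_w: "norm (\<Sum>i\<in>S. w i) = sqrt (\<Sum>i\<in>S. (\<sigma> i)\<^sup>2)" if "S \<subseteq> {1..?m}" for S
    unfolding w_def using is_svd_norm_sum[OF svd that] by (intro real_sqrt_unique[symmetric]) auto
  have "norm (\<Sum>i\<in>{1..?m}. \<A> (w i)) \<le>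
      C * (sqrt (\<Sum>i\<in>{1..?m}. (\<sigma> i)\<^sup>2) + (1 / sqrt r) * (\<Sum>i\<in>{1..?m}. \<sigma> i))"
  proof (rule norm_sum_blocks_le[OF r C])
    fix S assume S: "S \<subseteq> {1..?m}" "card S \<le> r"
    then have "finite S" using finite_subset by blast
    then have "rank (\<Sum>i\<in>S. w i) \<le> r"
      unfolding w_def using S(2) rank_sum_outer_product_le order_trans by blast
    then show "norm (\<Sum>i\<in>S. \<A> (w i)) \<le> C * sqrt (\<Sum>i\<in>S. (\<sigma> i)\<^sup>2)"
      using A[of "\<Sum>i\<in>S. w i"] norm_w[OF S(1)] by (simp add: A.sum)
  qed (use svd in \<open>auto simp: is_svd_def\<close>)
  then show ?thesis
    unfolding norm_w[OF order_refl, symmetric] A.sum[symmetric] M[symmetric]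
    unfolding nuclear_norm_def \<sigma>_def .
qed

section \<open>Iterative hard thresholding\<close>

text \<open>The constant \<open>c / (1 - a)\<close> is the fixed point of the map sending
  \<open>t\<close> to \<open>a * t + c\<close>.\<close>

lemma affine_recursion_bound:
  fixes d :: "nat \<Rightarrow> real"
  assumes "0 \<le> a" "a < 1" and "\<And>k. d (Suc k) \<le> a * d k + c" and "0 \<le> c"
  shows "d k \<le> a ^ k * d 0 + c / (1 - a)"
proof (induction k)
  case 0
  then show ?case using assms by simp
next
  case (Suc k)
  have "d (Suc k) \<le> a * d k + c" by (rule assms)
  also have "\<dots> \<le> a * (a ^ k * d 0 + c / (1 - a)) + c"
    using Suc assms(1) by (intro add_right_mono mult_left_mono)
  also have "\<dots> = a ^ Suc k * d 0 + c / (1 - a)"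
    using assms(2) by (simp add: field_simps)
  finally show ?case .
qed

lemma IHT_step:
  fixes \<A> :: "real^'n^'m \<Rightarrow> real^'p" and Xr Z Z' :: "real^'n^'m"
  assumes lin: "linear \<A>" and r: "1 \<le> r" "r \<le> CARD('m)"
    and rip: "\<And>W. rank W \<le> 3 * r \<Longrightarrow> (1 - \<delta>) * (norm W)\<^sup>2 \<le> (norm (\<A> W))\<^sup>2
                 \<and> (norm (\<A> W))\<^sup>2 \<le> (1 + \<delta>) * (norm W)\<^sup>2"
    and rank: "rank Xr \<le> r" "rank Z \<le> r"
    and Z': "Z' \<in> best_rank_approx r (Z - adjoint \<A> (\<A> Z - (\<A> Xr + e)))"
    and \<delta>: "0 \<le> \<delta>"
  shows "norm (Z' - Xr) \<le> 2 * \<delta> * norm (Z - Xr) + 2 * sqrt (1 + \<delta>) * norm e"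
proof -
  interpret A: linear \<A> by fact
  define Y where "Y = Z - adjoint \<A> (\<A> Z - (\<A> Xr + e))"
  define D where "D = Z - Xr"
  define D' where "D' = Z' - Xr"
  have rZ': "rank Z' \<le> r" using Z' by (rule rank_best_rank_approx_le)
  have "norm (Y - Z') \<le> norm (Y - Xr)"
    unfolding Y_def by (rule Eckart_Young_Frobenius[OF Z' r rank(1)])
  \<comment> \<open>Expanding the left side cancels the square of \<open>Y - Xr\<close> and leaves a
    bound on \<open>D'\<close> by an inner product.\<close>
  then have "(norm ((Y - Xr) - D'))\<^sup>2 \<le> (norm (Y - Xr))\<^sup>2"
    by (intro power_mono) (auto simp: D'_def)
  then have "(norm D')\<^sup>2 \<le> 2 * ((Y - Xr) \<bullet> D')"
    by (simp add: power2_norm_eq_inner inner_diff_left inner_diff_right inner_commute)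
  also have "Y - Xr = D - adjoint \<A> (\<A> D - e)"
    unfolding Y_def D_def by (simp add: A.diff algebra_simps)
  also have "(D - adjoint \<A> (\<A> D - e)) \<bullet> D' = (D \<bullet> D' - \<A> D \<bullet> \<A> D') + e \<bullet> \<A> D'"
    by (simp add: inner_diff_left adjoint_clauses(2)[OF lin])
  finally have 1: "(norm D')\<^sup>2 \<le> 2 * ((D \<bullet> D' - \<A> D \<bullet> \<A> D') + e \<bullet> \<A> D')" .
  \<comment> \<open>Only \<open>Z\<close>, \<open>Z'\<close> and \<open>Xr\<close> enter, each of
    rank at most \<open>r\<close>; this is where the order \<open>3 * r\<close> comes from.\<close>
  have comb: "rank (s *\<^sub>R D + t *\<^sub>R D') \<le> 3 * r" for s t
  proof -
    have "s *\<^sub>R D + t *\<^sub>R D' = s *\<^sub>R Z + (t *\<^sub>R Z' + (- s - t) *\<^sub>R Xr)"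
      by (simp add: D_def D'_def algebra_simps)
    also have "rank \<dots> \<le> rank (s *\<^sub>R Z) + (rank (t *\<^sub>R Z') + rank ((- s - t) *\<^sub>R Xr))"
      by (meson rank_add_le add_left_mono order_trans)
    also have "\<dots> \<le> rank Z + (rank Z' + rank Xr)"
      by (intro add_mono rank_scaleR_le)
    finally show ?thesis using rank rZ' by simp
  qed
  have 2: "D \<bullet> D' - \<A> D \<bullet> \<A> D' \<le> \<delta> * norm D * norm D'"
    using rip comb by (intro restricted_isometry_inner_le[OF lin]) blast
  have "(norm (\<A> D'))\<^sup>2 \<le> (1 + \<delta>) * (norm D')\<^sup>2"
    using rip comb[of 0 1] by simp
  then have 3: "norm (\<A> D') \<le> sqrt (1 + \<delta>) * norm D'"
    using real_sqrt_le_mono by (fastforce simp: real_sqrt_mult)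
  have "e \<bullet> \<A> D' \<le> norm e * norm (\<A> D')" by (rule norm_cauchy_schwarz)
  also have "\<dots> \<le> norm e * (sqrt (1 + \<delta>) * norm D')" using 3 by (rule mult_left_mono) simp
  finally have 4: "norm D' * norm D' \<le> (2 * \<delta> * norm D + 2 * sqrt (1 + \<delta>) * norm e) * norm D'"
    using 1 2 by (simp add: power2_eq_square algebra_simps)
  have "norm D' \<le> 2 * \<delta> * norm D + 2 * sqrt (1 + \<delta>) * norm e"
  proof (cases "D' = 0")
    case True
    have "0 \<le> 2 * \<delta> * norm D + 2 * sqrt (1 + \<delta>) * norm e" using \<delta> by simp
    then show ?thesis using True by simp
  next
    case False
    then have "0 < norm D'" by simp
    then show ?thesis by (rule mult_right_le_imp_le[OF 4])
  qed
  then show ?thesis unfolding D_def D'_def .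
qed

lemma power_mult_le_of_log:
  fixes a d \<epsilon> :: real
  assumes a: "0 < a" "a < 1" and "0 \<le> d" and "0 < \<epsilon>"
  shows "a ^ nat \<lceil>log (1 / a) (d / \<epsilon>)\<rceil> * d \<le> \<epsilon>"
\<comment> \<open>For \<open>d = 0\<close> the product vanishes whatever value the logarithm takes
  at 0.\<close>
proof (cases "d = 0")
  case True
  then show ?thesis using assms(4) by (simp only: mult_zero_right less_imp_le)
next
  case False
  define k where "k = nat \<lceil>log (1 / a) (d / \<epsilon>)\<rceil>"
  have pos: "0 < d / \<epsilon>" using False assms(3,4) by simp
  have a': "1 < 1 / a" using a by simp
  have "log (1 / a) (d / \<epsilon>) \<le> real k"
    unfolding k_def by (rule real_nat_ceiling_ge)
  then have "d / \<epsilon> \<le> (1 / a) powr real k"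
    by (simp only: log_le_iff[OF a' pos])
  also have "\<dots> = (1 / a) ^ k" using a by (intro powr_realpow) auto
  finally have "d / \<epsilon> \<le> 1 / a ^ k" by (simp only: power_one_over)
  then show ?thesis
    unfolding k_def[symmetric] using a assms(4) by (simp add: field_simps)
qed

text \<open>\<open>rank X0 \<le> r\<close> brings the first error within reach of the isometry
  property of order \<open>3 * r\<close>, and \<open>0 < \<epsilon>\<close> makes the quotient in
  the iteration count meaningful.\<close>

theorem theorem4p4:
  fixes \<A> :: "real^'n^'m \<Rightarrow> real^'p"
    and X Xr X0 :: "real^'n^'m"
    and x :: "nat \<Rightarrow> real^'n^'m"
    and b e :: "real^'p"
    and r :: nat
    and \<alpha> \<beta> \<gamma> \<epsilon> :: real
  assumes "CARD('m) \<le> CARD('n)"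
    and "1 \<le> r" and "3 * r \<le> CARD('m)"
    and "linear \<A>"
    and "b = \<A> X + e"
    and "0 < \<alpha>" and "\<alpha> < 1"
    and "restricted_isometry_constant (3 * r) \<A> \<le> \<alpha> / sqrt 8"
    and "Xr \<in> best_rank_approx r X"
    and "rank X0 \<le> r"
    and "IHT_iterates \<A> b r X0 x"
    and "\<beta> = 2 * sqrt (1 + \<alpha> / sqrt 8)"
    and "\<gamma> = \<beta>\<^sup>2 / (2 * (1 - \<alpha>)) + 1"
    and "\<epsilon> = norm (X - Xr) + 1 / sqrt (real r) * nuclear_norm (X - Xr) + norm e"
  shows "(\<forall>k. norm (X - x k) \<le> \<alpha> ^ k * norm (Xr - X0) + \<gamma> * \<epsilon>) \<and>
         (0 < \<epsilon> \<longrightarrow>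
           norm (X - x (nat \<lceil>log (1 / \<alpha>) (norm (Xr - X0) / \<epsilon>)\<rceil>)) \<le> (1 + \<gamma>) * \<epsilon>)"
proof -
  interpret A: linear \<A> by fact
  \<comment> \<open>The upper bound replaces the constant itself: the isometry inequalities weaken
    as \<delta> grows, \<delta> is nonnegative, and \<beta> becomes exactly
    \<open>2 * sqrt (1 + \<delta>)\<close>.\<close>
  define \<delta> where "\<delta> = \<alpha> / sqrt 8"
  define C where "C = sqrt (1 + \<delta>)"
  have r: "1 \<le> r" "r \<le> CARD('m)" using assms(2,3) by auto
  have \<delta>: "0 \<le> \<delta>" using assms(6) by (simp add: \<delta>_def)
  have C: "1 \<le> C" using \<delta> by (simp add: C_def)
  have \<beta>: "\<beta> = 2 * C" using assms(12) by (simp add: C_def \<delta>_def)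
  have "2 \<le> sqrt 8" by (rule real_le_rsqrt) simp
  then have "\<alpha> * 2 \<le> \<alpha> * sqrt 8" using assms(6) by (intro mult_left_mono) auto
  then have \<delta>\<alpha>: "2 * \<delta> \<le> \<alpha>" by (simp add: \<delta>_def field_simps)
  have rip: "(1 - \<delta>) * (norm W)\<^sup>2 \<le> (norm (\<A> W))\<^sup>2 \<and> (norm (\<A> W))\<^sup>2 \<le> (1 + \<delta>) * (norm W)\<^sup>2"
    if "rank W \<le> 3 * r" for W
  proof -
    let ?d = "restricted_isometry_constant (3 * r) \<A>"
    have "(1 - \<delta>) * (norm W)\<^sup>2 \<le> (1 - ?d) * (norm W)\<^sup>2" "(1 + ?d) * (norm W)\<^sup>2 \<le> (1 + \<delta>) * (norm W)\<^sup>2"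
      using assms(8) unfolding \<delta>_def by (intro mult_right_mono; simp)+
    then show ?thesis
      using restricted_isometry_constant_attained[OF assms(4) _ that] r by fastforce
  qed
  have "\<exists>\<sigma> u v. is_svd (X - Xr) \<sigma> u v"
    using assms(9) is_svd_tail[OF _ r(2)] unfolding best_rank_approx_def by blast
  moreover have "norm (\<A> W) \<le> C * norm W" if "rank W \<le> r" for W
    using rip[of W] that real_sqrt_le_mono by (fastforce simp: C_def real_sqrt_mult)
  ultimately have AX: "norm (\<A> (X - Xr)) \<le>
      C * (norm (X - Xr) + 1 / sqrt r * nuclear_norm (X - Xr))"
    using norm_linear_le_nuclear_norm[OF assms(4) r, of C "X - Xr"] C by auto
  define e' where "e' = \<A> (X - Xr) + e"
  have b: "b = \<A> Xr + e'" by (simp add: assms(5) e'_def A.diff)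
  \<comment> \<open>The factor 1 is then raised to \<open>C\<close>, which is at least 1, so that
    all three parts of \<epsilon> carry the same factor.\<close>
  have "norm e' \<le> norm (\<A> (X - Xr)) + 1 * norm e"
    unfolding e'_def using norm_triangle_ineq[of "\<A> (X - Xr)" e] by simp
  also have "\<dots> \<le> C * (norm (X - Xr) + 1 / sqrt r * nuclear_norm (X - Xr)) + C * norm e"
    using AX C by (intro add_mono mult_right_mono) auto
  also have "\<dots> = C * \<epsilon>" unfolding assms(14) by (simp add: algebra_simps)
  finally have e': "norm e' \<le> C * \<epsilon>" .
  have C\<epsilon>: "0 \<le> C * \<epsilon>" using e' norm_ge_zero order_trans by blast
  have rXr: "rank Xr \<le> r" using assms(9) by (rule rank_best_rank_approx_le)
  have step: "x (Suc k) \<in> best_rank_approx r (x k - adjoint \<A> (\<A> (x k) - (\<A> Xr + e')))"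
    and x0: "x 0 = X0" for k
    using assms(11) unfolding IHT_iterates_def b by auto
  have rx: "rank (x k) \<le> r" for k
    by (cases k) (use assms(10) x0 rank_best_rank_approx_le[OF step] in auto)
  have rec: "norm (x (Suc k) - Xr) \<le> \<alpha> * norm (x k - Xr) + \<beta> * (C * \<epsilon>)" for k
  proof -
    have "norm (x (Suc k) - Xr) \<le> 2 * \<delta> * norm (x k - Xr) + 2 * sqrt (1 + \<delta>) * norm e'"
      using IHT_step[OF assms(4) r rip rXr rx step \<delta>] by blast
    also have "\<dots> \<le> \<alpha> * norm (x k - Xr) + \<beta> * (C * \<epsilon>)"
      using \<delta>\<alpha> e' C assms(6) unfolding C_def[symmetric] \<beta> by (intro add_mono mult_mono) auto
    finally show ?thesis .
  qed
  \<comment> \<open>Passing from \<open>Xr\<close> back to \<open>X\<close> costs at most one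
    \<epsilon>, the summand 1 in \<gamma>.\<close>
  have nuc: "norm (X - Xr) \<le> \<epsilon>"
  proof -
    have "\<exists>u v. is_svd (X - Xr) (singular_values (X - Xr)) u v"
      using someI_ex[OF \<open>\<exists>\<sigma> u v. is_svd (X - Xr) \<sigma> u v\<close>] by (simp add: singular_values_def)
    then have "0 \<le> nuclear_norm (X - Xr)"
      unfolding nuclear_norm_def by (intro sum_nonneg) (auto simp: is_svd_def)
    then show ?thesis unfolding assms(14) by simp
  qed
  have bound: "norm (X - x k) \<le> \<alpha> ^ k * norm (Xr - X0) + \<gamma> * \<epsilon>" for k
  proof -
    have "norm (x k - Xr) \<le> \<alpha> ^ k * norm (x 0 - Xr) + \<beta> * (C * \<epsilon>) / (1 - \<alpha>)"
      using affine_recursion_bound[of \<alpha> "\<lambda>k. norm (x k - Xr)", OF _ assms(7) rec]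
        assms(6) C C\<epsilon> \<beta> by simp
    \<comment> \<open>Since \<open>C\<close> is half of \<beta>, the limit of the recursion is the
      first summand of \<gamma> times \<epsilon>.\<close>
    moreover have "\<beta> * (C * \<epsilon>) / (1 - \<alpha>) = \<beta>\<^sup>2 / (2 * (1 - \<alpha>)) * \<epsilon>"
      using assms(7) unfolding \<beta> by (simp add: power2_eq_square field_simps)
    moreover have "norm (X - x k) \<le> norm (X - Xr) + norm (x k - Xr)"
      using norm_triangle_ineq4[of "X - Xr" "x k - Xr"] by simp
    moreover have "\<gamma> * \<epsilon> = \<beta>\<^sup>2 / (2 * (1 - \<alpha>)) * \<epsilon> + \<epsilon>"
      unfolding assms(13) by (simp add: distrib_right)
    ultimately show ?thesis using nuc by (simp add: x0 norm_minus_commute)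
  qed
  moreover have "norm (X - x (nat \<lceil>log (1 / \<alpha>) (norm (Xr - X0) / \<epsilon>)\<rceil>)) \<le> (1 + \<gamma>) * \<epsilon>"
    if "0 < \<epsilon>"
    using bound[of "nat \<lceil>log (1 / \<alpha>) (norm (Xr - X0) / \<epsilon>)\<rceil>"]
      power_mult_le_of_log[OF assms(6,7) norm_ge_zero that, of "Xr - X0"]
    by (simp add: distrib_right)
  ultimately show ?thesis by blast
qed

end
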